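(* Let $\bm F\in\mathbb R^{n\times m}$ be such that $\bm Q=\bm F\bm F^\top$ is invertible, let $\bm A=\bm Q^{-1}$, and let $Z=\{0,1\}^n$. Suppose that $\mathrm{supp}(\bm A)$ is a connected rooted tree with $k$ leaves, whose nodes $1,\dots,n$ are labeled so that every node has a label smaller than that of its parent (so the root is $n$). Then the number of nodes in the exact decision diagram for $X_{\bm F}$ constructed by processing the variables in the order $1,2,\dots,n$ of this labeling is at most $$n\left(\frac{n-1}{k}+2\right)^k=\mathcal O(n^{k+1}).$$
   Context: $\mathrm{supp}(\bm A)$ is the simple graph on vertex set $\{1,\dots,n\}$ with an edge $(i,j)$, $i\ne j$, iff $A_{ij}\neq0$. A leaf of a rooted tree is a node without children (so a path rooted at one of its ends has one leaf, and the one-node tree has one leaf). $X_{\bm F}=\{(x_0,\bm x,\bm z)\in\mathbb R\times\mathbb R^n\times\{0,1\}^n:\ \|\bm F^\top\bm x\|_2^2\le x_0,\ x_i(1-z_i)=0\ \forall i\}$. For a matrix $\bm H$, $\bm H_\downarrow$ denotes $\bm H$ with its first row deleted. The exact decision diagram for $X_{\bm F}$ (case $Z=\{0,1\}^n$) is a layered directed multigraph with layers $1,\dots,n+1$. Layer 1 contains one node, storing the matrix $\bm F$. Nodes of layer $\ell$ are identified with the matrices $\bm H\in\mathbb R^{(n+1-\ell)\times m}$ they store (equal matrices in the same layer are the same node; at layer $n+1$ there is the single empty matrix). From each node $\bm H$ of layer $\ell\le n$, with first row $\bm u^\top$, there are two arcs to layer $\ell+1$, one for each decision $\bar z\in\{0,1\}$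 for $z_\ell$: if $\bar z=0$, or if $\bar z=1$ and $\bm u=\bm 0$, the head is $\bm H_\downarrow$; if $\bar z=1$ and $\bm u\neq\bm 0$, the head is $\bm H_\downarrow(\bm I-\bm u\bm u^\top/\|\bm u\|_2^2)$. The nodes of the diagram are all those reachable from layer 1. *)

theory Defs
  imports
    "HOL-Library.Landau_Symbols"
    "Jordan_Normal_Form.Matrix"
    "Graph_Theory.Graph_Theory"
begin

text \<open>Row and column indices of a matrix are 0-based, whereas variables, graph vertices and
  layers are numbered from 1; hence the shift by one in the entries below. As in
  \<^theory>\<open>Graph_Theory.Digraph\<close>, an undirected simple graph is a symmetric digraph (here \<open>A\<close> is
  meant to be symmetric), each edge being a pair of opposite arcs.\<close>

definition supp_graph :: "real mat \<Rightarrow> (nat, nat \<times> nat) pre_digraph" where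
  "supp_graph A =
    \<lparr> verts = {1..dim_row A},
      arcs = {(i, j). i \<in> {1..dim_row A} \<and> j \<in> {1..dim_row A} \<and> i \<noteq> j \<and> A $$ (i - 1, j - 1) \<noteq> 0},
      tail = fst, head = snd \<rparr>"

text \<open>The library constant \<^const>\<open>tree\<close> counts an edge traversed back and forth as a cycle, so no
  symmetric digraph with an edge satisfies it. Cycles of an undirected simple graph have length at
  least 3. Connectedness includes that there is at least one vertex.\<close>

definition undirected_tree :: "('a, 'b) pre_digraph \<Rightarrow> bool" where
  "undirected_tree G \<longleftrightarrow> connected G \<and> \<not> (\<exists>p. pre_digraph.cycle G p \<and> 3 \<le> length p)"

text \<open>In the tree \<open>G\<close> rooted at \<open>r\<close>, the parent of \<open>v\<close> is the vertex following \<open>v\<close> on the simple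
  path from \<open>v\<close> to \<open>r\<close>; the root has no parent.\<close>

definition is_parent :: "('a, 'b) pre_digraph \<Rightarrow> 'a \<Rightarrow> 'a \<Rightarrow> 'a \<Rightarrow> bool" where
  "is_parent G r v w \<longleftrightarrow> (\<exists>e p. pre_digraph.apath G v (e # p) r \<and> head G e = w)"

definition leaves :: "('a, 'b) pre_digraph \<Rightarrow> 'a \<Rightarrow> 'a set" where
  "leaves G r = {w \<in> verts G. \<not> (\<exists>v \<in> verts G. is_parent G r v w)}"

definition drop_first_row :: "'a mat \<Rightarrow> 'a mat" where
  "drop_first_row H = mat (dim_row H - 1) (dim_col H) (\<lambda>(i, j). H $$ (Suc i, j))"

text \<open>The matrix $I - u u^T / \|u\|_2^2$.\<close>

definition proj_mat :: "real vec \<Rightarrow> real mat" where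
  "proj_mat u =
    1\<^sub>m (dim_vec u) - (1 / (u \<bullet> u)) \<cdot>\<^sub>m mat (dim_vec u) (dim_vec u) (\<lambda>(i, j). u $ i * u $ j)"

text \<open>The matrix at the head of the arc for decision \<open>z\<close> (\<open>True\<close> for 1, \<open>False\<close> for 0) out of a node
  storing \<open>H\<close>.\<close>

definition dd_child :: "real mat \<Rightarrow> bool \<Rightarrow> real mat" where
  "dd_child H z =
    (let u = row H 0 in
     if z \<and> u \<noteq> 0\<^sub>v (dim_col H) then drop_first_row H * proj_mat u else drop_first_row H)"

text \<open>A node is a pair of its layer and the matrix it stores.\<close>

inductive_set dd_nodes :: "real mat \<Rightarrow> (nat \<times> real mat) set" for F where
  root: "(1, F) \<in> dd_nodes F"
| step: "(l, H) \<in> dd_nodes F \<Longrightarrow> l \<le> dim_row F \<Longrightarrow> (l + 1, dd_child H z) \<in> dd_nodes F"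

text \<open>An arc is a pair of its tail and its decision, so the two arcs out of a node remain distinct
  even when their heads coincide.\<close>

definition exact_dd :: "real mat \<Rightarrow> (nat \<times> real mat, (nat \<times> real mat) \<times> bool) pre_digraph" where
  "exact_dd F =
    \<lparr> verts = dd_nodes F,
      arcs = {((l, H), z). (l, H) \<in> dd_nodes F \<and> l \<le> dim_row F},
      tail = fst,
      head = (\<lambda>((l, H), z). (l + 1, dd_child H z)) \<rparr>"

end

theory Submission
  imports
    Defs
    "HOL-Analysis.Convex"
begin

text \<open>A node in layer \<open>l\<close> reached by setting \<open>z_i = 1\<close> exactly for \<open>i \<in> S \<subseteq> {1..<l}\<close> stores the
  residuals of the rows \<open>l, \<dots>, n\<close> of \<open>F\<close> after orthogonal projection onto the span of the rows in \<open>S\<close>.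
  The rows of \<open>A F\<close> are dual to those of \<open>F\<close>, so a zero of \<open>A\<close> acts like a conditional independence:
  the maximal elements \<open>T\<close> of \<open>S\<close> in the tree order separate the rest of \<open>S\<close> from the rows
  \<open>l, \<dots>, n\<close>, and the residuals with respect to \<open>S\<close> and \<open>T\<close> agree. Hence layer \<open>l\<close> has at most as
  many nodes as \<open>{1..<l}\<close> has antichains. An antichain has at most one element in each of the \<open>k\<close>
  chains into which the tree decomposes, which by AM-GM leaves at most \<open>((l - 1) / k + 1) ^ k\<close>
  possibilities. The last layer has a single node, paid for by \<open>y ^ k + 1 \<le> (y + 1) ^ k\<close>.\<close>

section \<open>Parents in rooted trees\<close>

context wf_digraph
begin

section \<open>Reachability avoiding a vertex, and the cycles it closes\<close>

text \<open>Adjacency in the graph with \<open>v\<close> deleted. As a plain relation, its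
  reachability can be composed and reversed without surgery on walks.\<close>

definition adj_avoiding :: "'a \<Rightarrow> ('a \<times> 'a) set" where
  "adj_avoiding v = {(tail G e, head G e) | e. e \<in> arcs G \<and> tail G e \<noteq> v \<and> head G e \<noteq> v}"

lemma sym_adj_avoiding:
  assumes "symmetric G"
  shows "sym (adj_avoiding v)"
proof (rule symI)
  fix a b assume "(a, b) \<in> adj_avoiding v"
  then have "a \<rightarrow> b" "a \<noteq> v" "b \<noteq> v"
    by (auto simp: adj_avoiding_def in_arcs_imp_in_arcs_ends)
  moreover from this(1) have "b \<rightarrow> a"
    using assms by (rule arcs_ends_symmetric[rotated])
  ultimately show "(b, a) \<in> adj_avoiding v"
    by (auto simp: adj_avoiding_def arcs_ends_conv)
qed

text \<open>Only the heads are asserted to avoid \<open>v\<close>: the empty walk also covers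
  \<open>u = w = v\<close>.\<close>

lemma awalk_of_adj_avoiding:
  assumes "(u, w) \<in> (adj_avoiding v)\<^sup>*" "w \<in> verts G"
  shows "\<exists>p. awalk u p w \<and> (\<forall>e \<in> set p. head G e \<noteq> v)"
  using assms
proof (induction rule: converse_rtrancl_induct)
  case base
  then show ?case by (intro exI[of _ "[]"]) (simp add: awalk_Nil_iff)
next
  case (step y z)
  then obtain p where p: "awalk z p w" "\<forall>e \<in> set p. head G e \<noteq> v" by blast
  from step(1) obtain e where e: "e \<in> arcs G" "y = tail G e" "z = head G e" "head G e \<noteq> v"
    by (auto simp: adj_avoiding_def)
  show ?case using p e by (intro exI[of _ "e # p"]) (simp add: awalk_Cons_iff)
qed

lemma adj_avoiding_of_awalk:
  assumes "awalk u p w" "v \<notin> set (awalk_verts u p)" "x \<in> set (awalk_verts u p)"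
  shows "(u, x) \<in> (adj_avoiding v)\<^sup>*"
  using assms
proof (induction p arbitrary: u)
  case Nil
  then show ?case by simp
next
  case (Cons e p)
  have e: "e \<in> arcs G" "tail G e = u" "awalk (head G e) p w"
    using Cons.prems(1) by (auto simp: awalk_Cons_iff)
  have hd: "head G e \<in> set (awalk_verts (head G e) p)"
    using e(3) by (rule hd_in_awalk_verts)
  show ?case
  proof (cases "x = u")
    case False
    then have "(head G e, x) \<in> (adj_avoiding v)\<^sup>*"
      using Cons e by auto
    moreover have "(u, head G e) \<in> adj_avoiding v"
      using Cons.prems(2) e hd by (auto simp: adj_avoiding_def)
    ultimately show ?thesis by (meson converse_rtrancl_into_rtrancl)
  qed simp
qed

text \<open>If two distinct neighbours \<open>u\<close>, \<open>w\<close> of \<open>v\<close> are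
  still joined once \<open>v\<close> is deleted, a simple path between them closes up through
  \<open>v\<close>. In a tree this is a contradiction.\<close>

lemma cycle_through:
  assumes "u \<noteq> w" "(u, w) \<in> (adj_avoiding v)\<^sup>*" "u \<noteq> v"
    and "d \<in> arcs G" "tail G d = v" "head G d = u" and "e \<in> arcs G" "tail G e = w" "head G e = v"
  shows "\<exists>p. cycle p \<and> 3 \<le> length p"
proof -
  obtain p where p: "awalk u p w" "\<forall>e \<in> set p. head G e \<noteq> v"
    using awalk_of_adj_avoiding[OF assms(2)] assms(7,8) by auto
  define q where "q = awalk_to_apath p"
  have q: "apath u q w"
    unfolding q_def using p(1) by (rule apath_awalk_to_apath)
  then have walk: "awalk u q w" and dist: "distinct (awalk_verts u q)"
    by (auto simp: apath_def)
  have "\<forall>e \<in> set q. head G e \<noteq> v"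
    using p awalk_to_apath_subset[OF p(1)] by (auto simp: q_def)
  \<comment> \<open>The vertices of a walk are its start and the heads of its arcs, and the start
    \<open>u\<close> differs from \<open>v\<close>.\<close>
  moreover have "set (awalk_verts u q) \<subseteq> insert u (head G ` set q)"
    using walk awalk_verts_conv'[of u q w]
    by (cases q) (auto simp: awalk_def simp del: awalk_verts.simps)
  ultimately have avoid: "v \<notin> set (awalk_verts u q)"
    using assms(3) by auto
  have w': "awalk v (d # q @ [e]) v"
    using assms walk by (auto simp: awalk_simps)
  have "awalk_verts u (q @ [e]) = awalk_verts u q @ [v]"
    using awalk_verts_append[of u q "[e]" v] assms walk by (auto simp: awalk_simps)
  then have "distinct (tl (awalk_verts v (d # q @ [e])))"
    using dist avoid assms by simp
  then have "cycle (d # q @ [e])"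
    using w' unfolding cycle_def by blast
  \<comment> \<open>This is what yields length 3: with \<open>q\<close> empty, \<open>d\<close> and
    \<open>e\<close> would only go back and forth.\<close>
  moreover have "q \<noteq> []"
    using walk assms(1) by (auto simp: awalk_Nil_iff)
  ultimately show ?thesis
    by (intro exI[of _ "d # q @ [e]"]) (cases q; simp)
qed

lemma reverse_arc_of_symmetric:
  assumes "symmetric G" "e \<in> arcs G"
  shows "\<exists>e' \<in> arcs G. tail G e' = head G e \<and> head G e' = tail G e"
  using arcs_ends_symmetric[OF assms(1) in_arcs_imp_in_arcs_ends[OF assms(2)]]
  by (auto simp: arcs_ends_conv)

section \<open>Uniqueness of parents, and the orientation of arcs\<close>

lemma is_parentE:
  assumes "is_parent G r v w"
  obtains e p where "e \<in> arcs G" "tail G e = v" "head G e = w" "awalk w p r"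
    "v \<notin> set (awalk_verts w p)" "distinct (awalk_verts w p)"
proof -
  obtain e p where "apath v (e # p) r" "head G e = w"
    using assms by (auto simp: is_parent_def)
  then show ?thesis
    by (intro that[of e p]) (auto simp: awalk_Cons_iff apath_def)
qed

lemma is_parent_imp_reachable_avoiding:
  assumes "is_parent G r v w"
  shows "(w, r) \<in> (adj_avoiding v)\<^sup>*" "w \<noteq> v"
proof -
  obtain e p where p: "awalk w p r" "v \<notin> set (awalk_verts w p)"
    using is_parentE[OF assms] by metis
  have "r \<in> set (awalk_verts w p)" "w \<in> set (awalk_verts w p)"
    using p(1) awalkE[OF p(1)] by (metis awalk_verts_non_Nil last_in_set, metis hd_in_awalk_verts(1))
  then show "(w, r) \<in> (adj_avoiding v)\<^sup>*" "w \<noteq> v"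
    using adj_avoiding_of_awalk[OF p] p(2) by auto
qed

text \<open>Two parents of \<open>v\<close> both reach \<open>r\<close> without passing through
  \<open>v\<close>, hence reach each other that way and close a cycle through
  \<open>v\<close>.\<close>

lemma is_parent_unique:
  assumes "symmetric G" "undirected_tree G" "is_parent G r v w" "is_parent G r v w'"
  shows "w = w'"
proof (rule ccontr)
  assume "w \<noteq> w'"
  obtain d where d: "d \<in> arcs G" "tail G d = v" "head G d = w"
    using is_parentE[OF assms(3)] by metis
  obtain e' where "e' \<in> arcs G" "tail G e' = v" "head G e' = w'"
    using is_parentE[OF assms(4)] by metis
  then obtain e where e: "e \<in> arcs G" "tail G e = w'" "head G e = v"
    using reverse_arc_of_symmetric[OF assms(1)] by blast
  have "(r, w') \<in> (adj_avoiding v)\<^sup>*"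
    using is_parent_imp_reachable_avoiding(1)[OF assms(4)] sym_rtrancl[OF sym_adj_avoiding[OF assms(1)]]
    by (meson symD)
  then have "(w, w') \<in> (adj_avoiding v)\<^sup>*"
    using is_parent_imp_reachable_avoiding(1)[OF assms(3)] by (rule rtrancl_trans[rotated])
  then show False
    using cycle_through[OF \<open>w \<noteq> w'\<close> _ is_parent_imp_reachable_avoiding(2)[OF assms(3)] d e] assms(2)
    by (auto simp: undirected_tree_def)
qed

text \<open>Consider the simple path from \<open>v\<close> to \<open>r\<close>. If it misses
  \<open>w\<close>, prefixing the reversed arc makes \<open>v\<close> the parent of
  \<open>w\<close>. If it meets \<open>w\<close>, its first step must go to \<open>w\<close>, since
  otherwise a cycle through \<open>v\<close> arises.\<close>

lemma is_parent_of_arc: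
  assumes "symmetric G" "undirected_tree G" "r \<in> verts G"
    and d: "d \<in> arcs G" "tail G d = v" "head G d = w" and "v \<noteq> w"
  shows "is_parent G r v w \<or> is_parent G r w v"
proof -
  have "v \<in> verts G" "w \<in> verts G" using d by auto
  then have "v \<rightarrow>\<^sup>* r"
    using symmetric_connected_imp_strongly_connected[OF assms(1)] assms(2,3)
    by (auto simp: undirected_tree_def strongly_connected_def)
  then obtain p where p: "apath v p r"
    by (auto simp: reachable_apath)
  obtain e where e: "e \<in> arcs G" "tail G e = w" "head G e = v"
    using reverse_arc_of_symmetric[OF assms(1) d(1)] d by blast
  show ?thesis
  proof (cases "w \<in> set (awalk_verts v p)")
    case False
    then have "apath w (e # p) r"
      using p e by (simp add: apath_Cons_iff)
    then show ?thesis using e by (auto simp: is_parent_def)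
  next
    case True
    then obtain c q where c: "p = c # q"
      using \<open>v \<noteq> w\<close> by (cases p) auto
    have q: "c \<in> arcs G" "tail G c = v" "apath (head G c) q r" "v \<notin> set (awalk_verts (head G c) q)"
      using p by (auto simp: c apath_Cons_iff)
    have "w \<in> set (awalk_verts (head G c) q)"
      using True \<open>v \<noteq> w\<close> q(2) by (auto simp: c)
    then have reach: "(head G c, w) \<in> (adj_avoiding v)\<^sup>*"
      using adj_avoiding_of_awalk q by (auto simp: apath_def)
    have "head G c \<noteq> v"
      using q(4) hd_in_awalk_verts(2)[OF q(3)] by auto
    then have "head G c = w"
      using cycle_through[OF _ reach _ q(1,2) refl e] assms(2) by (auto simp: undirected_tree_def)
    then show ?thesis using p by (auto simp: is_parent_def c)
  qed
qed

end

section \<open>Counting antichains in a forest\<close>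

lemma prod_le_mean_power:
  fixes a :: "'a \<Rightarrow> real"
  assumes "finite L" "L \<noteq> {}" "\<And>i. i \<in> L \<Longrightarrow> 0 \<le> a i"
  shows "(\<Prod>i\<in>L. a i) \<le> (sum a L / card L) ^ card L"
proof -
  have pos: "card L > 0" using assms(1,2) by (simp add: card_gt_0_iff)
  have nonneg: "0 \<le> (\<Prod>i\<in>L. a i)" using assms(3) by (rule prod_nonneg)
  have "(\<Prod>i\<in>L. a i) = ((\<Prod>i\<in>L. a i) powr (1 / card L)) ^ card L"
    using pos nonneg by (cases "(\<Prod>i\<in>L. a i) = 0") (simp_all add: powr_power)
  also have "\<dots> \<le> (\<Sum>i\<in>L. a i / card L) ^ card L"
    using arith_geom_mean[OF assms] by (intro power_mono) auto
  finally show ?thesis by (simp add: sum_divide_distrib)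
qed

text \<open>A set on which \<open>f\<close> is injective meets each fibre in at most one point, so
  it amounts to choosing from each fibre a point or nothing. AM-GM bounds the product of the fibre
  sizes plus one, whose sum is \<open>card V + card L\<close>.\<close>

lemma card_inj_on_subsets_le:
  fixes V L :: "nat set"
  assumes "finite V" "0 \<notin> V" "finite L" "L \<noteq> {}" "f ` V \<subseteq> L"
  shows "real (card {T. T \<subseteq> V \<and> inj_on f T}) \<le> (real (card V) / real (card L) + 1) ^ card L"
proof -
  define B where "B a = {v \<in> V. f v = a}" for a
  \<comment> \<open>The value 0 encodes an empty choice, which is unambiguous because 0 is not in
    \<open>V\<close>.\<close>
  define P where "P = (\<Pi>\<^sub>E a\<in>L. insert 0 (B a))"
  have finB: "finite (B a)" for a using assms(1) by (simp add: B_def)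
  have finP: "finite P" unfolding P_def using finB assms(3) by (intro finite_PiE) auto
  have "{T. T \<subseteq> V \<and> inj_on f T} \<subseteq> (\<lambda>\<phi>. \<phi> ` L - {0}) ` P"
  proof
    fix T assume "T \<in> {T. T \<subseteq> V \<and> inj_on f T}"
    then have T: "T \<subseteq> V" "inj_on f T" by auto
    define \<phi> where "\<phi> = (\<lambda>a\<in>L. if a \<in> f ` T then the_inv_into T f a else 0)"
    have val: "\<phi> (f t) = t" if "t \<in> T" for t
      using that T assms(5) by (auto simp: \<phi>_def the_inv_into_f_f)
    have "\<phi> \<in> P"
    proof -
      have "\<phi> a \<in> insert 0 (B a)" if "a \<in> L" for a
      proof (cases "a \<in> f ` T")
        case True
        then show ?thesis using val T by (auto simp: B_def)
      qed (use that in \<open>simp add: \<phi>_def\<close>)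
      then show ?thesis by (auto simp: P_def \<phi>_def)
    qed
    moreover have "\<phi> ` L - {0} = T"
    proof
      show "\<phi> ` L - {0} \<subseteq> T"
      proof
        fix x assume "x \<in> \<phi> ` L - {0}"
        then obtain a where a: "a \<in> L" "x = \<phi> a" "x \<noteq> 0" by auto
        then have "a \<in> f ` T" by (auto simp: \<phi>_def split: if_splits)
        then show "x \<in> T" using val a by auto
      qed
      show "T \<subseteq> \<phi> ` L - {0}"
      proof
        fix t assume t: "t \<in> T"
        then have "f t \<in> L" "t \<noteq> 0" using T assms by auto
        then show "t \<in> \<phi> ` L - {0}" using val[OF t] by (metis DiffI image_eqI singletonD)
      qed
    qed
    ultimately show "T \<in> (\<lambda>\<phi>. \<phi> ` L - {0}) ` P" by blast
  qed
  then have "card {T. T \<subseteq> V \<and> inj_on f T} \<le> card P"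
    by (rule surj_card_le[OF finP])
  also have "card P = (\<Prod>a\<in>L. card (B a) + 1)"
    unfolding P_def using assms(2,3) finB by (subst card_PiE) (auto simp: B_def intro!: prod.cong)
  finally have "real (card {T. T \<subseteq> V \<and> inj_on f T}) \<le> (\<Prod>a\<in>L. real (card (B a)) + 1)"
    by (metis (mono_tags, lifting) of_nat_1 of_nat_add of_nat_le_iff of_nat_prod prod.cong)
  also have "\<dots> \<le> ((\<Sum>a\<in>L. real (card (B a)) + 1) / card L) ^ card L"
    using assms by (intro prod_le_mean_power) auto
  also have "(\<Sum>a\<in>L. real (card (B a)) + 1) = real (card V) + real (card L)"
  proof -
    have "V = (\<Union>a\<in>L. B a)" using assms(5) by (auto simp: B_def)
    then have "card V = card (\<Union>a\<in>L. B a)" by simp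
    also have "\<dots> = (\<Sum>a\<in>L. card (B a))"
      using assms(3) finB by (intro card_UN_disjoint) (auto simp: B_def)
    finally show ?thesis by (simp add: sum.distrib)
  qed
  finally show ?thesis
    using assms(3,4) by (simp add: add_divide_distrib card_gt_0_iff)
qed

text \<open>The case \<open>s = t\<close> is included, so no element of \<open>T\<close> lies on a
  cycle of \<open>r\<close>; the relations used below strictly increase labels and have no
  cycles.\<close>

definition antichain_on :: "('a \<times> 'a) set \<Rightarrow> 'a set \<Rightarrow> bool" where
  "antichain_on r T \<longleftrightarrow> (\<forall>s\<in>T. \<forall>t\<in>T. (s, t) \<notin> r\<^sup>+)"

text \<open>Sending every vertex to a leaf below it is injective on antichains, because the ancestors of a
  leaf form a chain.\<close>

lemma card_antichains_le:
  fixes par :: "(nat \<times> nat) set" and U V :: "nat set"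
  assumes "single_valued par" "\<And>v w. (v, w) \<in> par \<Longrightarrow> v \<in> U \<and> v < w"
    and "finite U" "0 \<notin> U" "U \<noteq> {}" "V \<subseteq> U"
  defines "L \<equiv> {w \<in> U. \<forall>v. (v, w) \<notin> par}"
  shows "real (card {T. T \<subseteq> V \<and> antichain_on par T}) \<le> (real (card V) / real (card L) + 1) ^ card L"
    and "card L > 0"
proof -
  \<comment> \<open>Children have smaller labels, so descending from child to child ends at a
    leaf.\<close>
  have leaf: "\<exists>a\<in>L. (a, v) \<in> par\<^sup>*" if "v \<in> U" for v
    using that
  proof (induction v rule: less_induct)
    case (less v)
    show ?case
    proof (cases "v \<in> L")
      case False
      then obtain u where u: "(u, v) \<in> par" using less.prems by (auto simp: L_def)
      then obtain a where "a \<in> L" "(a, u) \<in> par\<^sup>*" using less.IH[of u] assms(2) by blast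
      then show ?thesis using u by (meson rtrancl_into_rtrancl)
    qed auto
  qed
  have fin: "finite L" using assms(3) by (simp add: L_def)
  have ne: "L \<noteq> {}" using leaf assms(5) by blast
  from fin ne show "card L > 0" by (simp add: card_gt_0_iff)
  obtain f where f: "\<And>v. v \<in> U \<Longrightarrow> f v \<in> L \<and> (f v, v) \<in> par\<^sup>*"
    using leaf by metis
  have "inj_on f T" if T: "T \<subseteq> V" "antichain_on par T" for T
  proof (rule inj_onI)
    fix s t assume st: "s \<in> T" "t \<in> T" "f s = f t"
    then have "(f s, s) \<in> par\<^sup>*" "(f s, t) \<in> par\<^sup>*" using f T assms by (metis subset_iff)+
    then have "(s, t) \<in> par\<^sup>* \<or> (t, s) \<in> par\<^sup>*"
      using single_valued_confluent[OF assms(1)] by metis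
    then show "s = t"
      using T st by (auto simp: antichain_on_def rtrancl_eq_or_trancl)
  qed
  then have "{T. T \<subseteq> V \<and> antichain_on par T} \<subseteq> {T. T \<subseteq> V \<and> inj_on f T}" by auto
  moreover have finV: "finite V" using assms finite_subset by blast
  ultimately have "card {T. T \<subseteq> V \<and> antichain_on par T} \<le> card {T. T \<subseteq> V \<and> inj_on f T}"
    by (intro card_mono) auto
  also have "real \<dots> \<le> (real (card V) / real (card L) + 1) ^ card L"
    using assms f fin ne finV by (intro card_inj_on_subsets_le) auto
  finally show "real (card {T. T \<subseteq> V \<and> antichain_on par T}) \<le> (real (card V) / real (card L) + 1) ^ card L"
    by simp
qed

lemma antichain_of_maximal_elements:
  fixes par :: "(nat \<times> nat) set"
  assumes "\<And>v w. (v, w) \<in> par \<Longrightarrow> v < w" and "finite S"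
  obtains T where "T \<subseteq> S" "antichain_on par T" "\<And>s. s \<in> S - T \<Longrightarrow> \<exists>t\<in>T. (s, t) \<in> par\<^sup>+"
proof
  define T where "T = {s \<in> S. \<forall>t\<in>S. (s, t) \<notin> par\<^sup>+}"
  show "T \<subseteq> S" "antichain_on par T" by (auto simp: T_def antichain_on_def)
  show "\<exists>t\<in>T. (s, t) \<in> par\<^sup>+" if "s \<in> S - T" for s
  proof -
    define M where "M = {t \<in> S. (s, t) \<in> par\<^sup>+}"
    have M: "finite M" "M \<noteq> {}" using that assms(2) by (auto simp: M_def T_def)
    have less: "v < w" if "(v, w) \<in> par\<^sup>+" for v w
      using that by (induction rule: trancl_induct) (auto dest: assms(1))
    \<comment> \<open>Among the elements of \<open>S\<close> above \<open>s\<close>, the one with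
      the largest label is maximal: anything in \<open>S\<close> above it would also lie above
      \<open>s\<close>.\<close>
    have "Max M \<in> T"
    proof (rule ccontr)
      assume "Max M \<notin> T"
      then obtain t where t: "t \<in> S" "(Max M, t) \<in> par\<^sup>+"
        using Max_in[OF M] by (auto simp: T_def M_def)
      then have "t \<in> M" using Max_in[OF M] by (auto simp: M_def)
      then show False using Max_ge[OF M(1)] less[OF t(2)] by (meson leD)
    qed
    then show ?thesis using Max_in[OF M] by (auto simp: M_def)
  qed
qed

section \<open>Residuals of orthogonal projections\<close>

text \<open>Vectors are functions of which only the values below \<open>m\<close> count; this keeps
  the projection algebra free of dimension conditions.\<close>

definition dot :: "nat \<Rightarrow> (nat \<Rightarrow> real) \<Rightarrow> (nat \<Rightarrow> real) \<Rightarrow> real" where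
  "dot m x y = (\<Sum>j<m. x j * y j)"

lemma dot_commute: "dot m x y = dot m y x"
  by (simp add: dot_def mult.commute)

lemma dot_lincomb:
  assumes "\<And>j. j < m \<Longrightarrow> x j = a j + (\<Sum>i\<in>S. c i * f i j)"
  shows "dot m x y = dot m a y + (\<Sum>i\<in>S. c i * dot m (f i) y)"
proof -
  have "dot m x y = (\<Sum>j<m. a j * y j + (\<Sum>i\<in>S. c i * (f i j * y j)))"
    unfolding dot_def by (rule sum.cong) (auto simp: assms distrib_right sum_distrib_right mult.assoc)
  also have "\<dots> = dot m a y + (\<Sum>i\<in>S. \<Sum>j<m. c i * (f i j * y j))"
    by (simp add: sum.distrib dot_def sum.swap[of _ _ S])
  finally show ?thesis by (simp add: dot_def sum_distrib_left)
qed

text \<open>Expanding one factor of the inner product of \<open>x\<close> with itself gives 0.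
  Orthogonality is demanded only where the coefficient is nonzero, the form in which the separation
  argument supplies it.\<close>

lemma lincomb_orthogonal_eq_0:
  assumes "\<And>j. j < m \<Longrightarrow> x j = (\<Sum>i\<in>S. c i * f i j)" "\<And>i. i \<in> S \<Longrightarrow> c i \<noteq> 0 \<Longrightarrow> dot m x (f i) = 0" "j < m"
  shows "x j = 0"
proof -
  have "c i * dot m (f i) x = 0" if "i \<in> S" for i
    using assms(2)[OF that] by (cases "c i = 0") (auto simp: dot_commute[of m "f i"])
  then have "(\<Sum>i\<in>S. c i * dot m (f i) x) = 0"
    by (rule sum.neutral[OF ballI])
  moreover have "dot m x x = dot m (\<lambda>_. 0) x + (\<Sum>i\<in>S. c i * dot m (f i) x)"
    by (rule dot_lincomb) (simp add: assms(1))
  ultimately have "(\<Sum>j<m. x j * x j) = 0" by (simp add: dot_def)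
  then show ?thesis using assms(3) by (subst (asm) sum_nonneg_eq_0_iff) auto
qed

text \<open>Orthogonal projection onto the complement of the span of the \<open>f i\<close>, given
  by its two characterizing properties; it determines \<open>h\<close> only below
  \<open>m\<close>.\<close>

definition residual :: "nat \<Rightarrow> (nat \<Rightarrow> nat \<Rightarrow> real) \<Rightarrow> nat set \<Rightarrow> (nat \<Rightarrow> real) \<Rightarrow> (nat \<Rightarrow> real) \<Rightarrow> bool" where
  "residual m f S v h \<longleftrightarrow>
    (\<forall>i\<in>S. dot m h (f i) = 0) \<and> (\<exists>c. \<forall>j<m. v j = h j + (\<Sum>i\<in>S. c i * f i j))"

lemma residual_mono:
  assumes "residual m f T v h" "T \<subseteq> S" "finite S" "\<And>i. i \<in> S \<Longrightarrow> dot m h (f i) = 0"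
  shows "residual m f S v h"
proof -
  obtain c where c: "\<forall>j<m. v j = h j + (\<Sum>i\<in>T. c i * f i j)"
    using assms(1) by (auto simp: residual_def)
  have "(\<Sum>i\<in>T. c i * f i j) = (\<Sum>i\<in>S. (if i \<in> T then c i else 0) * f i j)" for j
    using assms(2,3) by (intro sum.mono_neutral_cong_left) auto
  then have "\<forall>j<m. v j = h j + (\<Sum>i\<in>S. (if i \<in> T then c i else 0) * f i j)"
    using c by simp
  then show ?thesis
    unfolding residual_def using assms(4) by (intro conjI exI[of _ "\<lambda>i. if i \<in> T then c i else 0"]) auto
qed

text \<open>The difference of two residuals lies in the span and is orthogonal to it.\<close>

lemma residual_unique:
  assumes "residual m f S v h" "residual m f S v h'" "j < m"
  shows "h j = h' j"
proof -
  obtain c c' where c: "\<forall>j<m. v j = h j + (\<Sum>i\<in>S. c i * f i j)" "\<forall>j<m. v j = h' j + (\<Sum>i\<in>S. c' i * f i j)"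
    using assms by (auto simp: residual_def)
  define x where "x j = h j - h' j" for j
  have x: "x j = (\<Sum>i\<in>S. (c' i - c i) * f i j)" if "j < m" for j
    using c[rule_format, OF that] by (simp add: x_def left_diff_distrib sum_subtractf)
  have "dot m x (f i) = 0" if "i \<in> S" for i
    using assms(1,2) that by (simp add: residual_def dot_def x_def left_diff_distrib sum_subtractf)
  then have "x j = 0" by (intro lincomb_orthogonal_eq_0[OF x _ assms(3)])
  then show ?thesis by (simp add: x_def)
qed

text \<open>The coefficient is the junk value 0 when \<open>u\<close> vanishes, which is the right one: then
  \<open>f s\<close> already lies in the span.\<close>

lemma residual_insert:
  assumes "finite S" "s \<notin> S" "residual m f S v h" "residual m f S (f s) u"
  shows "residual m f (insert s S) v (\<lambda>j. h j - dot m h u / dot m u u * u j)"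
proof -
  define \<alpha> where "\<alpha> = dot m h u / dot m u u"
  define g where "g j = h j - \<alpha> * u j" for j
  obtain c d where c: "\<And>j. j < m \<Longrightarrow> v j = h j + (\<Sum>i\<in>S. c i * f i j)"
    and d: "\<And>j. j < m \<Longrightarrow> f s j = u j + (\<Sum>i\<in>S. d i * f i j)"
    using assms by (auto simp: residual_def)
  have g: "dot m g y = dot m h y - \<alpha> * dot m u y" for y
    by (simp add: dot_def g_def left_diff_distrib sum_subtractf sum_distrib_left mult.assoc)
  have gS: "dot m g (f i) = 0" if "i \<in> S" for i
    using assms that by (simp add: g residual_def)
  \<comment> \<open>A vanishing norm forces \<open>u\<close> to vanish below \<open>m\<close>, so
    division by zero does not spoil the orthogonality of \<open>g\<close> and
    \<open>u\<close>.\<close>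
  have "dot m u u = 0 \<Longrightarrow> dot m h u = 0"
    unfolding dot_def by (subst (asm) sum_nonneg_eq_0_iff) auto
  then have "dot m g u = 0"
    by (simp add: g \<alpha>_def)
  moreover have "dot m (f s) g = dot m u g + (\<Sum>i\<in>S. d i * dot m (f i) g)"
    using d by (rule dot_lincomb)
  ultimately have "dot m g (f s) = 0"
    using gS by (simp add: dot_commute[of m "f _" g] dot_commute[of m u g])
  \<comment> \<open>The coefficients come from substituting
    \<open>u = f s - (sum of d i * f i)\<close> into
    \<open>v = g + \<alpha> * u + (sum of c i * f i)\<close>.\<close>
  moreover have "v j = g j + (\<Sum>i\<in>insert s S. (if i = s then \<alpha> else c i - \<alpha> * d i) * f i j)" if "j < m" for j
  proof -
    have "(\<Sum>i\<in>insert s S. (if i = s then \<alpha> else c i - \<alpha> * d i) * f i j)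
        = \<alpha> * f s j + (\<Sum>i\<in>S. (c i - \<alpha> * d i) * f i j)"
      using assms(1,2) by (auto intro!: sum.cong)
    also have "\<dots> = \<alpha> * f s j + (\<Sum>i\<in>S. c i * f i j) - \<alpha> * (\<Sum>i\<in>S. d i * f i j)"
      by (simp add: left_diff_distrib sum_subtractf sum_distrib_left mult.assoc)
    finally show ?thesis
      using c[OF that] d[OF that] by (simp add: g_def algebra_simps)
  qed
  ultimately have "residual m f (insert s S) v g"
    using gS unfolding residual_def
    by (intro conjI exI[of _ "\<lambda>i. if i = s then \<alpha> else c i - \<alpha> * d i"]) auto
  then show ?thesis
    by (simp add: g_def[abs_def] \<alpha>_def)
qed

text \<open>Gram-Schmidt; \<open>v\<close> stays arbitrary because the residual of
  \<open>f s\<close> is needed as well.\<close>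

lemma residual_exists:
  assumes "finite S"
  shows "\<exists>h. residual m f S v h"
  using assms
proof (induction S arbitrary: v rule: finite_induct)
  case empty
  then show ?case by (intro exI[of _ v]) (simp add: residual_def)
next
  case (insert s S)
  then show ?case by (meson residual_insert)
qed

text \<open>The residual of \<open>v\<close> on \<open>T\<close> and that on \<open>C \<union> T\<close> differ by a linear combination of the \<open>f i\<close>
  whose coefficients at \<open>C\<close>, read off by the dual vectors, vanish; being orthogonal to the remaining
  \<open>f i\<close>, it is zero.\<close>

lemma residual_separator:
  assumes fin: "finite C" "finite T"
    and dual: "\<And>c. c \<in> C \<Longrightarrow> \<exists>g a. (\<forall>j<m. g j = (\<Sum>i\<in>C \<union> T. a i * f i j))
        \<and> (\<forall>i\<in>C \<union> T. dot m (f i) g = (if i = c then 1 else 0)) \<and> dot m v g = 0"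
    and disj: "C \<inter> T = {}" and h: "residual m f T v h"
  shows "residual m f (C \<union> T) v h"
proof -
  obtain y where y: "residual m f (C \<union> T) v y"
    using residual_exists fin by (metis finite_UnI)
  obtain b where b: "\<And>j. j < m \<Longrightarrow> v j = y j + (\<Sum>i\<in>C \<union> T. b i * f i j)"
    using y unfolding residual_def by blast
  obtain c where c: "\<And>j. j < m \<Longrightarrow> v j = h j + (\<Sum>i\<in>T. c i * f i j)"
    using h unfolding residual_def by blast
  define x where "x j = y j - h j" for j
  define e where "e i = (if i \<in> T then c i else 0) - b i" for i
  have x: "x j = (\<Sum>i\<in>C \<union> T. e i * f i j)" if "j < m" for j
  proof -
    have "(\<Sum>i\<in>T. c i * f i j) = (\<Sum>i\<in>C \<union> T. (if i \<in> T then c i else 0) * f i j)"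
      using fin by (intro sum.mono_neutral_cong_left) auto
    then show ?thesis
      using b[OF that] c[OF that] by (simp add: x_def e_def left_diff_distrib sum_subtractf)
  qed
  have dx: "dot m x z = dot m y z - dot m h z" for z
    by (simp add: dot_def x_def left_diff_distrib sum_subtractf)
  have e: "e i = 0" if i: "i \<in> C" for i
  proof -
    obtain g a where g: "\<And>j. j < m \<Longrightarrow> g j = 0 + (\<Sum>i\<in>C \<union> T. a i * f i j)"
      "\<forall>l\<in>C \<union> T. dot m (f l) g = (if l = i then 1 else 0)" "dot m v g = 0"
      using dual[OF i] by auto
    have "dot m g y = dot m (\<lambda>_. 0) y + (\<Sum>l\<in>C \<union> T. a l * dot m (f l) y)"
      using g(1) by (rule dot_lincomb)
    \<comment> \<open>The dual vector \<open>g\<close> lies in the span over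
      \<open>C \<union> T\<close>, to which \<open>y\<close> is orthogonal.\<close>
    then have yg: "dot m y g = 0"
      using y by (simp add: residual_def dot_commute[of m "f _" y] dot_commute[of m g y] dot_def[of m "\<lambda>_. 0"])
    have "dot m v g = dot m h g + (\<Sum>l\<in>T. c l * dot m (f l) g)"
      using c by (rule dot_lincomb)
    moreover have "dot m (f l) g = 0" if "l \<in> T" for l
      using g(2) that i disj by auto
    \<comment> \<open>\<open>v\<close> and \<open>h\<close> differ by a combination over
      \<open>T\<close>, on which \<open>g\<close> vanishes.\<close>
    ultimately have hg: "dot m h g = 0" using g(3) by simp
    have "dot m x g = dot m (\<lambda>_. 0) g + (\<Sum>l\<in>C \<union> T. e l * dot m (f l) g)"
      by (rule dot_lincomb) (simp add: x)
    also have "\<dots> = (\<Sum>l\<in>C \<union> T. if l = i then e l else 0)"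
      using g(2) by (auto simp: dot_def[of m "\<lambda>_. 0"] intro!: sum.cong)
    also have "\<dots> = e i" using i fin by simp
    finally show ?thesis using dx yg hg by simp
  qed
  have x0: "x j = 0" if "j < m" for j
  proof (rule lincomb_orthogonal_eq_0[OF x _ that])
    fix i assume "i \<in> C \<union> T" "e i \<noteq> 0"
    then have "i \<in> T" using e by auto
    then show "dot m x (f i) = 0" using y h by (simp add: dx residual_def)
  qed
  have "dot m h (f i) = 0" if "i \<in> C \<union> T" for i
  proof -
    have "dot m h (f i) = dot m y (f i)"
      unfolding dot_def using x0 by (intro sum.cong) (auto simp: x_def)
    then show ?thesis using y that by (simp add: residual_def)
  qed
  then show ?thesis using fin by (intro residual_mono[OF h]) auto
qed

section \<open>The layers of the diagram\<close>

lemma dd_child_False: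
  assumes "H \<in> carrier_mat (Suc q) m"
  shows "dd_child H False \<in> carrier_mat q m"
    and "p < q \<Longrightarrow> j < m \<Longrightarrow> dd_child H False $$ (p, j) = H $$ (Suc p, j)"
  using assms by (auto simp: dd_child_def drop_first_row_def)

text \<open>Multiplying by \<open>proj_mat\<close> subtracts from each row its component along
  \<open>u\<close>. The formula also covers \<open>u = 0\<close>, where the subtracted multiple of
  \<open>u\<close> is zero.\<close>

lemma dd_child_True:
  assumes H: "H \<in> carrier_mat (Suc q) m"
  defines "u \<equiv> (\<lambda>j. H $$ (0, j))"
  shows "dd_child H True \<in> carrier_mat q m"
    and "p < q \<Longrightarrow> j < m \<Longrightarrow> dd_child H True $$ (p, j) =
      H $$ (Suc p, j) - dot m (\<lambda>j. H $$ (Suc p, j)) u / dot m u u * u j"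
proof -
  let ?u = "row H 0"
  have u: "?u $ i = u i" if "i < m" for i using that H by (simp add: u_def)
  have uu: "?u \<bullet> ?u = dot m u u"
    using H u by (auto simp: scalar_prod_def dot_def atLeast0LessThan intro!: sum.cong)
  show "dd_child H True \<in> carrier_mat q m"
    using H by (auto simp: dd_child_def drop_first_row_def proj_mat_def Let_def)
  assume p: "p < q" and j: "j < m"
  show "dd_child H True $$ (p, j) =
      H $$ (Suc p, j) - dot m (\<lambda>j. H $$ (Suc p, j)) u / dot m u u * u j"
  proof (cases "?u = 0\<^sub>v m")
    case True
    then have "u i = 0" if "i < m" for i using u[OF that] that by simp
    then show ?thesis using True H p j by (auto simp: dd_child_def drop_first_row_def)
  next
    case False
    have "dd_child H True $$ (p, j) = (\<Sum>i<m. H $$ (Suc p, i) * (of_bool (i = j) - 1 / dot m u u * (u i * u j)))"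
      using False H p j u uu
      by (auto simp: dd_child_def drop_first_row_def proj_mat_def Let_def scalar_prod_def
          atLeast0LessThan u_def intro!: sum.cong)
    also have "\<dots> = (\<Sum>i<m. H $$ (Suc p, i) * of_bool (i = j))
        - (\<Sum>i<m. H $$ (Suc p, i) * u i) / dot m u u * u j"
      by (simp add: right_diff_distrib sum_subtractf sum_divide_distrib sum_distrib_right mult.assoc)
    also have "(\<Sum>i<m. H $$ (Suc p, i) * of_bool (i = j)) = H $$ (Suc p, j)"
      using j by (simp add: of_bool_def if_distrib cong: if_cong)
    finally show ?thesis by (simp add: dot_def[of m "\<lambda>j. H $$ (Suc p, j)"])
  qed
qed

text \<open>\<open>S\<close> collects the variables set to 1 on some path to the node, and row
  \<open>p\<close> belongs to variable \<open>l + p\<close>. The first row is the residual of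
  \<open>f l\<close>, so decision 1 is exactly the projection step that inserts \<open>l\<close>
  into \<open>S\<close>.\<close>

lemma dd_nodes_residual:
  fixes F :: "real mat"
  assumes F: "F \<in> carrier_mat n m" and node: "(l, H) \<in> dd_nodes F"
  defines "f \<equiv> (\<lambda>i j. F $$ (i - 1, j))"
  shows "1 \<le> l \<and> l \<le> n + 1 \<and> H \<in> carrier_mat (n + 1 - l) m \<and>
    (\<exists>S \<subseteq> {1..<l}. \<forall>p < n + 1 - l. residual m f S (f (l + p)) (\<lambda>j. H $$ (p, j)))"
  using node
proof (induction rule: dd_nodes.induct)
  case root
  then show ?case using F by (auto simp: f_def residual_def)
next
  case (step l H z)
  then have l: "1 \<le> l" "l \<le> n" using F by auto
  define q where "q = n - l"
  have q: "n + 1 - l = Suc q" "n + 1 - (l + 1) = q" using l by (auto simp: q_def)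
  obtain S where S: "S \<subseteq> {1..<l}"
    and res: "\<And>p. p < Suc q \<Longrightarrow> residual m f S (f (l + p)) (\<lambda>j. H $$ (p, j))"
    using step.IH q by auto
  have H: "H \<in> carrier_mat (Suc q) m" using step.IH q by simp
  have finS: "finite S" using S finite_subset by blast
  show ?case
  proof (cases z)
    case False
    have "residual m f S (f (l + 1 + p)) (\<lambda>j. dd_child H z $$ (p, j))" if "p < q" for p
    proof -
      have "residual m f S (f (l + 1 + p)) (\<lambda>j. H $$ (Suc p, j))"
        using res[of "Suc p"] that by simp
      then show ?thesis
        using dd_child_False(2)[OF H that] False by (simp add: residual_def dot_def)
    qed
    then show ?thesis
      using S l dd_child_False(1)[OF H] False unfolding q by (intro conjI exI[of _ S]) auto
  next
    case True
    have "residual m f (insert l S) (f (l + 1 + p)) (\<lambda>j. dd_child H z $$ (p, j))" if "p < q" for p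
    proof -
      let ?u = "\<lambda>j. H $$ (0, j)" and ?h = "\<lambda>j. H $$ (Suc p, j)"
      have "residual m f S (f (l + 1 + p)) ?h" "residual m f S (f l) ?u"
        using res[of "Suc p"] res[of 0] that by simp_all
      moreover have "l \<notin> S" using S by auto
      ultimately have "residual m f (insert l S) (f (l + 1 + p)) (\<lambda>j. ?h j - dot m ?h ?u / dot m ?u ?u * ?u j)"
        using finS by (intro residual_insert)
      then show ?thesis
        using dd_child_True(2)[OF H that] True by (simp add: residual_def dot_def)
    qed
    then show ?thesis
      using S l dd_child_True(1)[OF H] True unfolding q by (intro conjI exI[of _ "insert l S"]) auto
  qed
qed

section \<open>Separation in the tree and its effect on residuals\<close>

text \<open>Pairing row \<open>c\<close> of \<open>A * F\<close> with row \<open>i\<close> of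
  \<open>F\<close> gives an entry of \<open>A * (F * transpose_mat F)\<close>, the identity.\<close>

lemma dot_dual_vector:
  fixes A F :: "real mat"
  assumes F: "F \<in> carrier_mat n m" and A: "A \<in> carrier_mat n n"
    and inv: "A * (F * transpose_mat F) = 1\<^sub>m n" and ci: "c \<in> {1..n}" "i \<in> {1..n}"
  defines "f \<equiv> (\<lambda>i j. F $$ (i - 1, j))"
  shows "dot m (f i) (\<lambda>j. \<Sum>l\<in>{1..n}. A $$ (c - 1, l - 1) * f l j) = (if i = c then 1 else 0)"
proof -
  have lt: "c - 1 < n" "i - 1 < n" "(i = c) = (i - 1 = c - 1)" using ci by auto
  have "dot m (f i) (\<lambda>j. \<Sum>l\<in>{1..n}. A $$ (c - 1, l - 1) * f l j)
      = dot m (\<lambda>_. 0) (f i) + (\<Sum>l\<in>{1..n}. A $$ (c - 1, l - 1) * dot m (f l) (f i))"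
    by (subst dot_commute) (rule dot_lincomb, simp)
  also have "\<dots> = (\<Sum>l<n. A $$ (c - 1, l) * dot m (f (Suc l)) (f i))"
    by (simp add: dot_def[of m "\<lambda>_. 0"] sum.atLeast1_atMost_eq)
  also have "\<dots> = (A * (F * transpose_mat F)) $$ (c - 1, i - 1)"
    using F A lt
    by (auto simp: scalar_prod_def dot_def f_def atLeast0LessThan intro!: sum.cong)
  also have "\<dots> = (if i = c then 1 else 0)"
    unfolding inv using lt by simp
  finally show ?thesis .
qed

text \<open>Neighbours of a proper descendant of \<open>T\<close> are again descendants or lie in
  \<open>T\<close>. Its dual vector therefore combines only rows from \<open>C \<union> T\<close>
  and is orthogonal to \<open>f i\<close>, so \<open>T\<close> separates \<open>C\<close> from
  \<open>i\<close>.\<close>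

lemma residual_of_maximal_elements:
  fixes A F :: "real mat"
  assumes F: "F \<in> carrier_mat n m" and A: "A \<in> carrier_mat n n"
    and inv: "A * (F * transpose_mat F) = 1\<^sub>m n"
    and par: "single_valued par" "\<And>v w. (v, w) \<in> par \<Longrightarrow> v \<in> {1..n} \<and> v < w"
    and supp: "\<And>i j. i \<in> {1..n} \<Longrightarrow> j \<in> {1..n} \<Longrightarrow> i \<noteq> j \<Longrightarrow> A $$ (i - 1, j - 1) \<noteq> 0
        \<Longrightarrow> (i, j) \<in> par \<or> (j, i) \<in> par"
    and S: "S \<subseteq> {1..<l}" "T \<subseteq> S" "antichain_on par T" "\<And>s. s \<in> S - T \<Longrightarrow> \<exists>t\<in>T. (s, t) \<in> par\<^sup>+"
    and i: "l \<le> i" "i \<le> n"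
  defines "f \<equiv> (\<lambda>i j. F $$ (i - 1, j))"
  assumes h: "residual m f T (f i) h"
  shows "residual m f S (f i) h"
proof -
  \<comment> \<open>All proper descendants are taken, not just those in \<open>S\<close>, so that
    \<open>C \<union> T\<close> contains every neighbour of \<open>C\<close>.\<close>
  define C where "C = {c. \<exists>t\<in>T. (c, t) \<in> par\<^sup>+}"
  have less: "v \<in> {1..n} \<and> v < w" if "(v, w) \<in> par\<^sup>+" for v w
    using that by (induction rule: trancl_induct) (use par(2) in \<open>force+\<close>)
  have CT: "C \<subseteq> {1..<l}" "T \<subseteq> {1..<l}"
    using less S by (fastforce simp: C_def)+
  have fin: "finite C" "finite T" using CT finite_subset by blast+
  have closed: "j \<in> C \<union> T" if c: "c \<in> C" and j: "j \<in> {1..n}" "A $$ (c - 1, j - 1) \<noteq> 0" for c j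
  proof (cases "j = c")
    case False
    obtain t where t: "t \<in> T" "(c, t) \<in> par\<^sup>+" using c by (auto simp: C_def)
    have "(c, j) \<in> par \<or> (j, c) \<in> par"
      using supp[of c j] False j less[OF t(2)] by auto
    then show ?thesis
    proof
      assume cj: "(c, j) \<in> par"
      \<comment> \<open>The path from \<open>c\<close> up to \<open>t\<close> starts with the unique
        parent of \<open>c\<close>, which is thus \<open>t\<close> or still below
        \<open>t\<close>.\<close>
      obtain z where "(c, z) \<in> par" "(z, t) \<in> par\<^sup>*" using tranclD[OF t(2)] by auto
      moreover from this(1) have "z = j" using cj par(1) by (auto dest: single_valuedD)
      ultimately show ?thesis using t(1) by (auto simp: C_def rtrancl_eq_or_trancl)
    next
      assume "(j, c) \<in> par"
      then have "(j, t) \<in> par\<^sup>+" using t(2) by (rule trancl_into_trancl2)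
      then show ?thesis using t(1) by (auto simp: C_def)
    qed
  qed (use c in simp)
  have "residual m f (C \<union> T) (f i) h"
  proof (rule residual_separator[OF fin])
    show "C \<inter> T = {}" using S(3) by (auto simp: C_def antichain_on_def)
    show "residual m f T (f i) h" by (rule h)
    fix c assume c: "c \<in> C"
    define g where "g j = (\<Sum>l\<in>{1..n}. A $$ (c - 1, l - 1) * f l j)" for j
    have sub: "C \<union> T \<subseteq> {1..n}" using CT i by auto
    then have cn: "c \<in> {1..n}" using c by auto
    have dot: "dot m (f k) g = (if k = c then 1 else 0)" if "k \<in> {1..n}" for k
      using dot_dual_vector[OF F A inv cn that] unfolding g_def[abs_def] f_def .
    have "A $$ (c - 1, k - 1) = 0" if "k \<in> {1..n} - (C \<union> T)" for k
      using closed[OF c, of k] that by blast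
    then have "g j = (\<Sum>k\<in>C \<union> T. A $$ (c - 1, k - 1) * f k j)" for j
      unfolding g_def using sub by (intro sum.mono_neutral_right) (simp_all del: One_nat_def)
    moreover have "i \<in> {1..n}" "i \<noteq> c" using i c CT by auto
    ultimately show "\<exists>g a. (\<forall>j<m. g j = (\<Sum>k\<in>C \<union> T. a k * f k j))
        \<and> (\<forall>k\<in>C \<union> T. dot m (f k) g = (if k = c then 1 else 0)) \<and> dot m (f i) g = 0"
      using dot sub by (intro exI[of _ g] exI[of _ "\<lambda>k. A $$ (c - 1, k - 1)"]) auto
  qed
  moreover have "S \<subseteq> C \<union> T" using S(4) by (auto simp: C_def)
  \<comment> \<open>The decomposition over \<open>T\<close> carries over to \<open>S\<close>, and
    orthogonality on \<open>S\<close> is inherited from \<open>C \<union> T\<close>.\<close>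
  ultimately show ?thesis
    using S(1,2) finite_subset[OF S(1)] by (intro residual_mono[OF h]) (auto simp: residual_def)
qed

text \<open>The maximal elements \<open>T\<close> of \<open>S\<close> determine the node: residuals
  on \<open>T\<close> are residuals on \<open>S\<close>, and those are unique.\<close>

lemma dd_layer_subset:
  fixes A F :: "real mat"
  assumes F: "F \<in> carrier_mat n m" and A: "A \<in> carrier_mat n n"
    and inv: "A * (F * transpose_mat F) = 1\<^sub>m n"
    and par: "single_valued par" "\<And>v w. (v, w) \<in> par \<Longrightarrow> v \<in> {1..n} \<and> v < w"
    and supp: "\<And>i j. i \<in> {1..n} \<Longrightarrow> j \<in> {1..n} \<Longrightarrow> i \<noteq> j \<Longrightarrow> A $$ (i - 1, j - 1) \<noteq> 0
        \<Longrightarrow> (i, j) \<in> par \<or> (j, i) \<in> par"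
  shows "\<exists>\<Phi>. {H. (l, H) \<in> dd_nodes F} \<subseteq> \<Phi> ` {T. T \<subseteq> {1..<l} \<and> antichain_on par T}"
proof -
  define f where "f = (\<lambda>i j. F $$ (i - 1, j))"
  \<comment> \<open>The choice is arbitrary at indices from \<open>m\<close> on, but
    \<open>\<Phi>\<close> reads only entries below \<open>m\<close>.\<close>
  define R where "R T i = (SOME h. residual m f T (f i) h)" for T i
  define \<Phi> where "\<Phi> T = mat (n + 1 - l) m (\<lambda>(p, j). R T (l + p) j)" for T
  have "H \<in> \<Phi> ` {T. T \<subseteq> {1..<l} \<and> antichain_on par T}" if node: "(l, H) \<in> dd_nodes F" for H
  proof -
    obtain S where l: "l \<le> n + 1" and H: "H \<in> carrier_mat (n + 1 - l) m" and S: "S \<subseteq> {1..<l}"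
      and res: "\<And>p. p < n + 1 - l \<Longrightarrow> residual m f S (f (l + p)) (\<lambda>j. H $$ (p, j))"
      using dd_nodes_residual[OF F node] unfolding f_def by blast
    have "finite S" using S finite_subset by blast
    with par(2) obtain T where T: "T \<subseteq> S" "antichain_on par T"
      "\<And>s. s \<in> S - T \<Longrightarrow> \<exists>t\<in>T. (s, t) \<in> par\<^sup>+"
      using antichain_of_maximal_elements[of par S] by metis
    have finT: "finite T" using T(1) \<open>finite S\<close> finite_subset by blast
    have "H = \<Phi> T"
    proof (rule eq_matI)
      fix p j assume pj: "p < dim_row (\<Phi> T)" "j < dim_col (\<Phi> T)"
      then have p: "p < n + 1 - l" and j: "j < m" by (auto simp: \<Phi>_def)
      have "residual m f T (f (l + p)) (R T (l + p))"
        unfolding R_def using residual_exists[OF finT] by (rule someI_ex)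
      then have "residual m f S (f (l + p)) (R T (l + p))"
        using residual_of_maximal_elements[OF F A inv par supp S T, of "l + p"] p
        unfolding f_def by simp
      then have "H $$ (p, j) = R T (l + p) j"
        using residual_unique[OF res[OF p]] j by blast
      then show "H $$ (p, j) = \<Phi> T $$ (p, j)" using p j by (simp add: \<Phi>_def)
    qed (use H in \<open>auto simp: \<Phi>_def\<close>)
    then show ?thesis using T S by blast
  qed
  then show ?thesis by blast
qed

section \<open>Symmetry of the inverse, numerical estimates and the node count\<close>

text \<open>The transpose of \<open>A\<close> is a left inverse of \<open>Q\<close>, hence equals
  the right inverse \<open>A\<close>. This makes the support graph symmetric.\<close>

lemma inverse_of_symmetric_mat:
  fixes A Q :: "'a :: comm_ring_1 mat"
  assumes "A \<in> carrier_mat n n" "Q \<in> carrier_mat n n" "Q * A = 1\<^sub>m n" "transpose_mat Q = Q"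
  shows "transpose_mat A = A"
proof -
  have tA: "transpose_mat A \<in> carrier_mat n n" using assms(1) by simp
  have "transpose_mat A * Q = 1\<^sub>m n"
    using transpose_mult[OF assms(2,1)] assms(3,4) by simp
  then have "A = (transpose_mat A * Q) * A" using assms(1) by simp
  also have "\<dots> = transpose_mat A * (Q * A)" using tA assms by (intro assoc_mult_mat)
  finally show ?thesis using tA assms(3) by simp
qed

lemma power_add_1_le:
  fixes y :: real
  assumes "0 \<le> y" "k > 0"
  shows "y ^ k + 1 \<le> (y + 1) ^ k"
proof -
  obtain q where k: "k = Suc q" using assms(2) by (cases k) auto
  have "y * y ^ q + 1 * 1 \<le> y * (y + 1) ^ q + 1 * (y + 1) ^ q"
    using assms(1) by (intro add_mono mult_left_mono power_mono one_le_power) auto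
  then show ?thesis by (simp add: k distrib_right)
qed

text \<open>For \<open>N \<ge> 1\<close> the base is at most \<open>N + 1 \<le> 3 * N\<close>,
  whence the constant \<open>3 ^ k\<close>; for \<open>k = 0\<close> the quotient is 0 by
  convention.\<close>

lemma bound_in_bigo:
  "(\<lambda>N::nat. real N * ((real N - 1) / real k + 2) ^ k) \<in> O(\<lambda>N. real N ^ (k + 1))"
proof (rule bigoI[where c = "3 ^ k"])
  have "norm (real N * ((real N - 1) / real k + 2) ^ k) \<le> 3 ^ k * norm (real N ^ (k + 1))" if "N \<ge> 1" for N
  proof -
    have "(real N - 1) / real k \<le> real N - 1"
      using that frac_le[of "real N - 1" "real N - 1" 1 "real k"] by (cases "k = 0") auto
    then have "(real N - 1) / real k + 2 \<le> 3 * real N" using that by auto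
    moreover have "0 \<le> (real N - 1) / real k + 2" using that by (simp add: add_nonneg_pos)
    ultimately have "real N * ((real N - 1) / real k + 2) ^ k \<le> real N * (3 * real N) ^ k"
      by (intro mult_left_mono power_mono) auto
    then show ?thesis
      using \<open>0 \<le> (real N - 1) / real k + 2\<close> by (simp add: power_mult_distrib mult.commute mult.left_commute)
  qed
  then show "\<forall>\<^sub>F N in sequentially. norm (real N * ((real N - 1) / real k + 2) ^ k)
      \<le> 3 ^ k * norm (real N ^ (k + 1))"
    unfolding eventually_sequentially by blast
qed

theorem corollary2:
  fixes F A :: "real mat" and n m k r :: nat
  assumes "F \<in> carrier_mat n m"
    and "invertible_mat (F * transpose_mat F)"
    and "A \<in> carrier_mat n n"
    and "inverts_mat (F * transpose_mat F) A" and "inverts_mat A (F * transpose_mat F)"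
    and "undirected_tree (supp_graph A)"
    and "r \<in> verts (supp_graph A)"
    and "card (leaves (supp_graph A) r) = k"
    and "\<And>i j. is_parent (supp_graph A) r i j \<Longrightarrow> i < j"
  shows "finite (verts (exact_dd F))
    \<and> real (card (verts (exact_dd F))) \<le> real n * ((real n - 1) / real k + 2) ^ k
    \<and> (\<lambda>N::nat. real N * ((real N - 1) / real k + 2) ^ k) \<in> O(\<lambda>N. real N ^ (k + 1))"
proof -
  let ?Q = "F * transpose_mat F" and ?G = "supp_graph A"
  have Q: "?Q \<in> carrier_mat n n" using assms(1) by simp
  have AQ: "A * ?Q = 1\<^sub>m n" and QA: "?Q * A = 1\<^sub>m n"
    using assms(1,3-5) by (auto simp: inverts_mat_def)
  have "transpose_mat ?Q = ?Q"
    using transpose_mult[OF assms(1), of "transpose_mat F" n] assms(1) by simp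
  then have "transpose_mat A = A" by (rule inverse_of_symmetric_mat[OF assms(3) Q QA])
  then have symA: "A $$ (i, j) = A $$ (j, i)" if "i < n" "j < n" for i j
    using that assms(3) by (metis carrier_matD index_transpose_mat(1))
  interpret wf_digraph ?G
    by unfold_locales (auto simp: supp_graph_def)
  have G: "verts ?G = {1..n}"
    "arcs ?G = {(i, j). i \<in> {1..n} \<and> j \<in> {1..n} \<and> i \<noteq> j \<and> A $$ (i - 1, j - 1) \<noteq> 0}"
    "tail ?G = fst" "head ?G = snd"
    using assms(3) by (auto simp: supp_graph_def)
  have sym: "symmetric ?G"
  proof -
    have "arcs_ends ?G = arcs ?G"
      by (simp add: arcs_ends_def arc_to_ends_def G(3,4))
    then show ?thesis
      unfolding symmetric_def G using symA by (auto intro!: symI)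
  qed
  define par where "par = {(v, w). is_parent ?G r v w}"
  have par_sv: "single_valued par"
    using is_parent_unique[OF sym assms(6)] by (auto simp: par_def single_valued_def)
  have par_less: "v \<in> {1..n} \<and> v < w" if "(v, w) \<in> par" for v w
  proof -
    have "is_parent ?G r v w" using that by (simp add: par_def)
    moreover from this have "v \<in> verts ?G" by (auto elim: is_parentE)
    ultimately show ?thesis using assms(9) G(1) by simp
  qed
  have supp: "(i, j) \<in> par \<or> (j, i) \<in> par"
    if "i \<in> {1..n}" "j \<in> {1..n}" "i \<noteq> j" "A $$ (i - 1, j - 1) \<noteq> 0" for i j
    using is_parent_of_arc[OF sym assms(6,7), of "(i, j)" i j] that G by (auto simp: par_def)
  have leaves: "leaves ?G r = {w \<in> {1..n}. \<forall>v. (v, w) \<notin> par}"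
    using par_less by (auto simp: leaves_def G par_def)
  have n: "n > 0" using assms(7) G(1) by auto
  \<comment> \<open>Both facts carry the guard on \<open>l\<close>; positivity of \<open>k\<close>
    is later extracted at \<open>l = 0\<close>.\<close>
  have k: "k > 0"
    and anti: "real (card {T. T \<subseteq> {1..<l} \<and> antichain_on par T}) \<le> (real (l - 1) / real k + 1) ^ k"
    if "l \<le> n + 1" for l
  proof -
    have "{1..<l} \<subseteq> {1..n}" using that by auto
    note * = card_antichains_le[OF par_sv par_less _ _ _ this, folded leaves, unfolded assms(8)]
    show "k > 0" using * n by simp
    show "real (card {T. T \<subseteq> {1..<l} \<and> antichain_on par T}) \<le> (real (l - 1) / real k + 1) ^ k"
      using *(1) n by simp
  qed
  define N where "N l = {H. (l, H) \<in> dd_nodes F}" for l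
  have "\<forall>l. \<exists>\<Phi>. N l \<subseteq> \<Phi> ` {T. T \<subseteq> {1..<l} \<and> antichain_on par T}"
    unfolding N_def using dd_layer_subset[OF assms(1,3) AQ par_sv par_less supp] by (intro allI)
  then obtain \<Phi> where \<Phi>: "\<And>l. N l \<subseteq> \<Phi> l ` {T. T \<subseteq> {1..<l} \<and> antichain_on par T}"
    by (auto dest!: choice)
  have finN: "finite (N l)" for l
    using \<Phi>[of l] by (rule finite_subset) simp
  let ?x = "(real n - 1) / real k"
  have layer: "real (card (N l)) \<le> (?x + 1) ^ k" if "l \<in> {1..n}" for l
  proof -
    have "real (card (N l)) \<le> real (card {T. T \<subseteq> {1..<l} \<and> antichain_on par T})"
      using surj_card_le[OF _ \<Phi>[of l]] by simp
    also have "\<dots> \<le> (real (l - 1) / real k + 1) ^ k" using that by (intro anti) simp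
    also have "\<dots> \<le> (?x + 1) ^ k"
      using that by (intro power_mono add_right_mono divide_right_mono) auto
    finally show ?thesis .
  qed
  \<comment> \<open>The antichain bound for this layer would add an \<open>(n + 1)\<close>-st large
    term; its matrices have no rows, so they all coincide.\<close>
  have last: "card (N (n + 1)) \<le> 1"
  proof -
    have "N (n + 1) \<subseteq> {mat 0 m (\<lambda>_. 0)}"
      using dd_nodes_residual[OF assms(1)] by (force simp: N_def intro!: eq_matI)
    from card_mono[OF _ this] show ?thesis by simp
  qed
  have "dd_nodes F = (SIGMA l:{1..n + 1}. N l)"
    using dd_nodes_residual[OF assms(1)] by (auto simp: N_def)
  then have V: "verts (exact_dd F) = (SIGMA l:{1..n + 1}. N l)" by (simp add: exact_dd_def)
  have x: "0 \<le> ?x" using n by simp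
  have "real (card (verts (exact_dd F))) = (\<Sum>l\<in>{1..n + 1}. real (card (N l)))"
    unfolding V using finN by (subst card_SigmaI) auto
  also have "\<dots> = (\<Sum>l\<in>{1..n}. real (card (N l))) + real (card (N (n + 1)))" by simp
  also have "\<dots> \<le> (\<Sum>l\<in>{1..n}. (?x + 1) ^ k) + 1"
    using layer last by (intro add_mono sum_mono) auto
  \<comment> \<open>As \<open>n \<ge> 1\<close>, the single last node is charged to the first
    \<open>n\<close> layers, one extra node each.\<close>
  also have "\<dots> \<le> real n * ((?x + 1) ^ k + 1)"
    using n by (simp add: distrib_left)
  also have "\<dots> \<le> real n * (?x + 1 + 1) ^ k"
    using x k[of 0] power_add_1_le[of "?x + 1" k] by (intro mult_left_mono) auto
  finally have "real (card (verts (exact_dd F))) \<le> real n * (?x + 2) ^ k" by (simp add: add.assoc)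
  moreover have "finite (verts (exact_dd F))" unfolding V using finN by auto
  ultimately show ?thesis using bound_in_bigo by blast
qed

end
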